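(* The characteristic polynomial $\chi(P;z)$ of polymatroids $P$ is not, in general, a specialization of the polymatroid Tutte polynomial $\mathcal{T}_P$.
   Context: A polymatroid is a pair $P=(E,r)$ with $E$ a finite set and $r:2^E\to\mathbb{Z}$ such that $r(\emptyset)=0$, $r(A)\le r(B)$ whenever $A\subseteq B$, and $r(A)+r(B)\ge r(A\cup B)+r(A\cap B)$ for all $A,B\subseteq E$. Characteristic polynomial: $\chi(P;z)=\sum_{A\subseteq E}(-1)^{|A|}z^{r(E)-r(A)}$. The polymatroid Tutte polynomial $\mathcal{T}_P(x,y)\in\mathbb{Z}[x,y]$ (Bernardi–Kálmán–Postnikov) is given recursively: $\mathcal{T}_P=1$ if $E=\emptyset$. Otherwise fix any $e\in E$, set $\alpha_e=r(E)-r(E\setminus\{e\})$, $\beta_e=r(\{e\})$, and for each integer $\alpha_e\le j\le\beta_e$ let $P_{e,j}$ be the polymatroid on $E\setminus\{e\}$ with rank function $r_{e,j}(A)=\min\{r(A),\,r(A\cup\{e\})-j\}$ (so $P_{e,\alpha_e}=P\setminus e$ is the deletion and $P_{e,\beta_e}=P/e$ the contraction). Then $\mathcal{T}_P=(x+y-1)\mathcal{T}_{P\setminus e}$ if $\alpha_e=\beta_e$, and $\mathcal{T}_P=x\,\mathcal{T}_{P\setminus e}+y\,\mathcal{T}_{P/e}+\sum_{j=\alpha_e+1}^{\beta_e-1}\mathcal{T}_{P_{e,j}}$ if $\alpha_e<\beta_e$. It is known that the result is independent of the choices of $e$. Meaning of "specialization": the word is used informally, for an invariant that can be obtained from $\mathcal{T}_P$.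 Non-specialization is derived from the fact that $\chi$ is not determined by $\mathcal{T}_P$, by means of the following pair. A hypergraph $H=(V,E)$ has an associated polymatroid $P_H=(E,r)$ with $r(A)=|V|-\kappa(A)$, where $\kappa(A)$ is the number of connected components of the hypergraph $(V,A)$. On $V=\{a,b,c,d,e,f,g,h\}$ let $H_3$ have edges $\{a,b,c,h\},\{a,b,d,h\},\{a,b,e,h\},\{a,c,f,h\},\{a,d,g,h\}$ and let $H_4$ have edges $\{a,b,c,h\},\{a,b,d,h\},\{a,b,e,h\},\{a,c,f,h\},\{a,f,g,h\}$. Both associated polymatroids have $5$ elements and rank $7$, and $\mathcal{T}_{P_{H_3}}=\mathcal{T}_{P_{H_4}}$, but $\chi(P_{H_3};z)=z^7-5z^4+5z^3-z$ and $\chi(P_{H_4};z)=z^7-5z^4+5z^3+z^2-3z+1$. *)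

theory Defs
  imports "HOL-Computational_Algebra.Polynomial"
begin

text \<open>The rank function is total on sets of the ambient type; only its values on subsets
  of the ground set \<open>E\<close> are constrained, and only these values are ever used below.\<close>

locale polymatroid =
  fixes E :: "'a set" and r :: "'a set \<Rightarrow> int"
  assumes finite_ground: "finite E"
    and rank_empty: "r {} = 0"
    and rank_mono: "\<And>A B. A \<subseteq> B \<Longrightarrow> B \<subseteq> E \<Longrightarrow> r A \<le> r B"
    and rank_submodular:
      "\<And>A B. A \<subseteq> E \<Longrightarrow> B \<subseteq> E \<Longrightarrow> r (A \<union> B) + r (A \<inter> B) \<le> r A + r B"

text \<open>For a polymatroid the exponent \<open>r E - r A\<close> is nonnegative, so \<open>nat\<close> does not truncate.\<close>

definition characteristic_poly :: "'a set \<Rightarrow> ('a set \<Rightarrow> int) \<Rightarrow> int poly" where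
  "characteristic_poly E r = (\<Sum>A\<in>Pow E. monom ((-1) ^ card A) (nat (r E - r A)))"

definition slice_rank :: "('a set \<Rightarrow> int) \<Rightarrow> 'a \<Rightarrow> int \<Rightarrow> 'a set \<Rightarrow> int" where
  "slice_rank r e j A = min (r A) (r (insert e A) - j)"

text \<open>The ring of integer polynomials in \<open>x\<close> and \<open>y\<close> is represented as polynomials in \<open>y\<close>
  whose coefficients are polynomials in \<open>x\<close>.\<close>

definition var_x :: "int poly poly" where
  "var_x = [:[:0, 1:]:]"

definition var_y :: "int poly poly" where
  "var_y = [:0, 1:]"

text \<open>For a polymatroid the recursion gives the same polynomial for every choice of the element
  \<open>e\<close> at each step; the definition takes the least one. Deletion and contraction of \<open>e\<close>
  are the slices at \<open>\<alpha>\<close> and \<open>\<beta>\<close>, see the lemmas below. The value for infinite \<open>E\<close>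
  is irrelevant.\<close>

function tutte_poly :: "'a::linorder set \<Rightarrow> ('a set \<Rightarrow> int) \<Rightarrow> int poly poly" where
  "tutte_poly E r =
    (if finite E \<and> E \<noteq> {} then
       let e = Min E;
           \<alpha> = r E - r (E - {e});
           \<beta> = r {e}
       in if \<alpha> = \<beta>
          then (var_x + var_y - 1) * tutte_poly (E - {e}) (slice_rank r e \<alpha>)
          else var_x * tutte_poly (E - {e}) (slice_rank r e \<alpha>)
             + var_y * tutte_poly (E - {e}) (slice_rank r e \<beta>)
             + (\<Sum>j\<in>{\<alpha><..<\<beta>}. tutte_poly (E - {e}) (slice_rank r e j))
     else 1)"
  by pat_completeness auto
termination
  by (relation "measure (\<lambda>(E, r). card E)") (auto simp: card_gt_0_iff)

declare tutte_poly.simps [simp del]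

context polymatroid
begin

lemma slice_rank_deletion:
  assumes "e \<in> E" "A \<subseteq> E - {e}"
  shows "slice_rank r e (r E - r (E - {e})) A = r A"
proof -
  have "insert e A \<union> (E - {e}) = E" "insert e A \<inter> (E - {e}) = A" "A \<subseteq> E"
    using assms by auto
  with rank_submodular[of "insert e A" "E - {e}"] assms show ?thesis
    by (auto simp: slice_rank_def)
qed

lemma slice_rank_contraction:
  assumes "e \<in> E" "A \<subseteq> E - {e}"
  shows "slice_rank r e (r {e}) A = r (insert e A) - r {e}"
proof -
  have "A \<inter> {e} = {}" "A \<union> {e} = insert e A" "A \<subseteq> E"
    using assms by auto
  with rank_submodular[of A "{e}"] rank_empty assms show ?thesis
    by (auto simp: slice_rank_def)
qed

end

end

theory Submission
  imports Defs
begin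

text \<open>For a modular polymatroid, i.e. one with rank function \<open>A \<mapsto> \<Sum>a\<in>A. w a\<close>, every slice
  interval degenerates to a point, so the Tutte polynomial is \<open>(x + y - 1)\<close> to the power
  \<open>card E\<close>, whatever the weights are. The characteristic polynomial, which is the product of
  the factors \<open>z ^ w a - 1\<close>, does depend on the weights: the weights \<open>(1, 3)\<close> and \<open>(2, 2)\<close> give
  two polymatroids without loops, of the same size and the same rank, that it distinguishes.
  This pair is smaller than the hypergraphic pair \<open>H\<^sub>3, H\<^sub>4\<close>.\<close>

lemma polymatroid_sum_weights:
  fixes w :: "'a \<Rightarrow> int"
  assumes "finite E" and "\<And>a. a \<in> E \<Longrightarrow> 0 \<le> w a"
  shows "polymatroid E (sum w)"
proof
  fix A B assume "A \<subseteq> B" "B \<subseteq> E"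
  with assms show "sum w A \<le> sum w B"
    by (intro sum_mono2) (auto intro: finite_subset)
next
  fix A B assume "A \<subseteq> E" "B \<subseteq> E"
  with assms(1) have "finite A" "finite B"
    by (auto intro: finite_subset)
  then show "sum w (A \<union> B) + sum w (A \<inter> B) \<le> sum w A + sum w B"
    by (simp add: sum.union_inter)
qed (use assms in auto)

text \<open>Agreement with the weight sum is required on subsets of \<open>E\<close> only, because slices of
  \<open>sum w\<close> deviate from \<open>sum w\<close> on sets containing the removed element.\<close>

lemma tutte_poly_modular:
  fixes w :: "'a::linorder \<Rightarrow> int"
  assumes "finite E" and "\<And>A. A \<subseteq> E \<Longrightarrow> r A = sum w A"
  shows "tutte_poly E r = (var_x + var_y - 1) ^ card E"
  using assms
proof (induction "card E" arbitrary: E r)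
  case 0
  then show ?case
    by (subst tutte_poly.simps) simp
next
  case (Suc n)
  define e where "e = Min E"
  from Suc.hyps(2) have "E \<noteq> {}"
    by auto
  with Suc.prems(1) have "e \<in> E"
    by (simp add: e_def)
  have card: "n = card (E - {e})"
    using Suc.hyps(2) Suc.prems(1) \<open>e \<in> E\<close> by simp
  have alpha: "r E - r (E - {e}) = w e"
    using Suc.prems \<open>e \<in> E\<close> by (simp add: sum.remove)
  have beta: "r {e} = w e"
    using Suc.prems(2) \<open>e \<in> E\<close> by simp
  \<comment> \<open>Adjoining \<open>e\<close> raises the rank by exactly \<open>w e\<close>, so
    both arguments of \<open>min\<close> coincide and the slice is again modular with weights
    \<open>w\<close>.\<close>
  have "slice_rank r e (w e) A = sum w A" if "A \<subseteq> E - {e}" for A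
  proof -
    have "finite A" "e \<notin> A" "A \<subseteq> E" "insert e A \<subseteq> E"
      using that Suc.prems(1) \<open>e \<in> E\<close> by (auto intro: finite_subset)
    then show ?thesis
      by (simp add: slice_rank_def Suc.prems(2))
  qed
  then have "tutte_poly (E - {e}) (slice_rank r e (w e)) = (var_x + var_y - 1) ^ n"
    using Suc.hyps(1)[OF card] Suc.prems(1) card by simp
  then have "tutte_poly E r = (var_x + var_y - 1) * (var_x + var_y - 1) ^ n"
    by (subst tutte_poly.simps)
      (simp add: Suc.prems(1) \<open>E \<noteq> {}\<close> alpha beta flip: e_def)
  then show ?case
    by (simp flip: Suc.hyps(2))
qed

text \<open>Sharing the ground set and the rank lets one pair refute both forms of specialization,
  with or without access to \<open>card E\<close> and \<open>r E\<close>.\<close>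

lemma equal_invariants_distinct_characteristic_poly:
  obtains E :: "nat set" and r r' :: "nat set \<Rightarrow> int"
  where "polymatroid E r" "polymatroid E r'" "r E = r' E" "tutte_poly E r = tutte_poly E r'"
    "characteristic_poly E r \<noteq> characteristic_poly E r'"
proof
  define w w' :: "nat \<Rightarrow> int" where "w a = (if a = 0 then 1 else 3)" and "w' a = 2" for a
  let ?E = "{0, 1 :: nat}"
  show "polymatroid ?E (sum w)" "polymatroid ?E (sum w')"
    by (auto intro!: polymatroid_sum_weights simp: w_def w'_def)
  show "sum w ?E = sum w' ?E"
    by (simp add: w_def w'_def)
  show "tutte_poly ?E (sum w) = tutte_poly ?E (sum w')"
    by (simp add: tutte_poly_modular)
  \<comment> \<open>The polynomials are (z - 1)(z^3 - 1) and (z^2 - 1)^2, with linear coefficients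
    -1 and 0.\<close>
  have "coeff (characteristic_poly ?E (sum w)) 1 \<noteq> coeff (characteristic_poly ?E (sum w')) 1"
    by (simp add: characteristic_poly_def Pow_insert w_def w'_def numeral_poly)
  then show "characteristic_poly ?E (sum w) \<noteq> characteristic_poly ?E (sum w')"
    by metis
qed

theorem corollary6p4:
  shows "\<not> (\<exists>F :: int poly poly \<Rightarrow> int poly.
            \<forall>(E :: nat set) (r :: nat set \<Rightarrow> int). polymatroid E r \<longrightarrow>
              characteristic_poly E r = F (tutte_poly E r))
       \<and> \<not> (\<exists>F :: nat \<Rightarrow> int \<Rightarrow> int poly poly \<Rightarrow> int poly.
            \<forall>(E :: nat set) (r :: nat set \<Rightarrow> int). polymatroid E r \<longrightarrow>
              characteristic_poly E r = F (card E) (r E) (tutte_poly E r))"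
  by (rule equal_invariants_distinct_characteristic_poly) metis

end
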